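(* Let $K=\mathrm{cone}\left\{\begin{pmatrix}\sqrt2\\1\end{pmatrix},\begin{pmatrix}0\\1\end{pmatrix}\right\}=\{x\in\mathbb{R}^2 : x_1\ge 0,\ -x_1+\sqrt2\,x_2\ge 0\}\subseteq\mathbb{R}^2$. Then $K$ is not IR. Moreover, its Ryshkov set $\mathcal{R}_K$ is not a locally finite polyhedron.
   Context: $\mathcal{S}^n$ is the space of real symmetric $n\times n$ matrices (here $n=2$); for $Q\in\mathcal{S}^n$ and $x\in\mathbb{R}^n$ write $Q[x]=x^{T}Qx$. For a closed convex cone $K\subseteq\mathbb{R}^n$, $\mathcal{COP}_K=\{Q\in\mathcal{S}^n : Q[x]\ge 0\text{ for all }x\in K\}$, and $\mathrm{bd}\,\mathcal{COP}_K$ is its topological boundary in $\mathcal{S}^n$. The generalized Ryshkov set is $\mathcal{R}_K=\{Q\in\mathcal{S}^n : Q[z]\ge 1\text{ for all } z\in K\cap\mathbb{Z}^n\setminus\{0\}\}$. The $K$-copositive minimum of $Q$ is $\min_{\mathcal{COP}_K}Q=\inf\{Q[z] : z\in K\cap\mathbb{Z}^n\setminus\{0\}\}$. $K$ is IR (has the Interior Ryshkov property) if $Q\in\mathrm{bd}\,\mathcal{COP}_K$ implies $\min_{\mathcal{COP}_K}Q=0$. A locally finite polyhedron is a convex set such that every intersection of the set with a polytope is a polytope as well (the empty set counts as a polytope). *)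

theory Defs
  imports "HOL-Analysis.Analysis"
begin

definition sym_matrices :: "(real^'n^'n) set" where
  "sym_matrices = {Q. transpose Q = Q}"

definition quad_form :: "real^'n^'n \<Rightarrow> real^'n \<Rightarrow> real" where
  "quad_form Q x = x \<bullet> (Q *v x)"

definition copositive :: "(real^'n) set \<Rightarrow> (real^'n^'n) set" where
  "copositive K = {Q \<in> sym_matrices. \<forall>x\<in>K. quad_form Q x \<ge> 0}"

definition nonzero_lattice_points :: "(real^'n) set \<Rightarrow> (real^'n) set" where
  "nonzero_lattice_points K = {z \<in> K. (\<forall>i. z $ i \<in> \<int>) \<and> z \<noteq> 0}"

definition ryshkov_set :: "(real^'n) set \<Rightarrow> (real^'n^'n) set" where
  "ryshkov_set K = {Q \<in> sym_matrices. \<forall>z\<in>nonzero_lattice_points K. quad_form Q z \<ge> 1}"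

(* The infimum is taken in the extended reals: it is \<infinity> if K contains no nonzero
   lattice point, and -\<infinity> if the values are unbounded below. *)
definition copositive_min :: "(real^'n) set \<Rightarrow> real^'n^'n \<Rightarrow> ereal" where
  "copositive_min K Q = (INF z\<in>nonzero_lattice_points K. ereal (quad_form Q z))"

(* The boundary is relative to the space of symmetric matrices, which is a proper
   subspace of real^'n^'n as soon as there are at least two indices; the frontier in
   real^'n^'n would be the whole (closed) copositive cone. *)
definition interior_ryshkov :: "(real^'n) set \<Rightarrow> bool" where
  "interior_ryshkov K \<longleftrightarrow>
     (\<forall>Q \<in> (top_of_set sym_matrices) frontier_of (copositive K). copositive_min K Q = 0)"

(* For sets P of symmetric matrices it makes no difference whether the test polytopes C
   range over real^'n^'n or only over the subspace of symmetric matrices; see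
   locally_finite_polyhedron_subspace below. *)
definition locally_finite_polyhedron :: "'a::euclidean_space set \<Rightarrow> bool" where
  "locally_finite_polyhedron P \<longleftrightarrow> convex P \<and> (\<forall>C. polytope C \<longrightarrow> polytope (P \<inter> C))"

lemma locally_finite_polyhedron_subspace:
  assumes "subspace V" and "P \<subseteq> V"
  shows "locally_finite_polyhedron P \<longleftrightarrow>
           convex P \<and> (\<forall>C. C \<subseteq> V \<and> polytope C \<longrightarrow> polytope (P \<inter> C))"
proof -
  have "polytope (P \<inter> C)"
    if h: "\<forall>C. C \<subseteq> V \<and> polytope C \<longrightarrow> polytope (P \<inter> C)" and C: "polytope C" for C
  proof -
    have "polytope (C \<inter> V)"
      using C assms(1) by (simp add: polytope_Int_polyhedron affine_imp_polyhedron subspace_imp_affine)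
    moreover have "P \<inter> (C \<inter> V) = P \<inter> C"
      using assms(2) by blast
    ultimately show ?thesis
      using h by (metis inf_le2)
  qed
  then show ?thesis
    unfolding locally_finite_polyhedron_def by blast
qed

lemma subspace_sym_matrices: "subspace sym_matrices"
  by (auto simp: subspace_def sym_matrices_def transpose_def vec_eq_iff)

end

theory Submission
  imports Defs
begin

text \<open>
  Everything rests on the Pell form \<open>2 q\<^sup>2 - p\<^sup>2 = (\<surd>2 q - p) (\<surd>2 q + p)\<close>. At points \<open>(p, q)\<close> of
  \<open>K\<close> both factors are nonnegative, and the first one vanishes along the irrational edge, so the
  form lies on the boundary of the copositive cone. A lattice point of \<open>K\<close> that is not the origin
  gives it an integer value, which is not \<open>0\<close> because \<open>\<surd>2\<close> is irrational. So the form is at least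
  \<open>1\<close> at all these points: its copositive minimum is not \<open>0\<close>, which refutes the interior Ryshkov
  property, and it belongs to the Ryshkov set (\<open>pell_ryshkov\<close>).

  Moreover the value \<open>1\<close> is attained infinitely often on \<open>K\<close>, at the solutions of the negative Pell
  equation \<open>p\<^sup>2 - 2 q\<^sup>2 = -1\<close> (\<open>infinite_pell_minimizers\<close>). Hence infinitely many of the inequalities
  \<open>Q[z] \<ge> 1\<close> are tight at the Pell form, and none of them follows from the other tight ones: given
  a solution \<open>z\<close>, adding a small multiple of the positive semidefinite form
  \<open>w \<mapsto> (z\<^sub>2 w\<^sub>1 - z\<^sub>1 w\<^sub>2)\<^sup>2\<close> stays in the Ryshkov set and keeps the inequality at \<open>z\<close> tight, but makes
  those at all other solutions strict, since distinct solutions are not parallel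
  (\<open>pell_minimizers_eq_of_parallel\<close>). So the tight inequalities cut out pairwise distinct faces of
  the intersection of the Ryshkov set with a large enough box. A polytope has only finitely many
  faces (\<open>finite_irredundant_inequalities\<close>), so this intersection is not a polytope.
\<close>

section \<open>Quadratic forms\<close>

definition outer :: "real^'n \<Rightarrow> real^'n^'n" where
  "outer v = (\<chi> i j. v $ i * v $ j)"

lemma outer_sym: "outer v \<in> sym_matrices"
  by (simp add: outer_def sym_matrices_def transpose_def vec_eq_iff mult.commute)

text \<open>
  For fixed \<open>x\<close> the value \<open>Q[x]\<close> is a linear functional of \<open>Q\<close>, so the inequalities that define the
  Ryshkov set are half-spaces.
\<close>
lemma quad_form_eq_inner_outer: "quad_form Q x = outer x \<bullet> Q"
  by (simp add: quad_form_def outer_def inner_vec_def matrix_vector_mult_def sum_distrib_left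
      mult_ac)

lemma quad_form_add: "quad_form (A + B) x = quad_form A x + quad_form B x"
  by (simp add: quad_form_eq_inner_outer inner_right_distrib)

lemma quad_form_scaleR: "quad_form (c *\<^sub>R A) x = c * quad_form A x"
  by (simp add: quad_form_eq_inner_outer)

lemma quad_form_mat_1: "quad_form (mat 1) x = x \<bullet> x"
  by (simp add: quad_form_def)

lemma quad_form_outer: "quad_form (outer v) x = (v \<bullet> x)\<^sup>2"
  by (simp add: quad_form_eq_inner_outer outer_def inner_vec_def power2_eq_square sum_product
      mult_ac)

lemma ryshkov_add_outer:
  assumes "Q \<in> ryshkov_set K" "c \<ge> 0"
  shows "Q + c *\<^sub>R outer v \<in> ryshkov_set K"
proof -
  have "Q + c *\<^sub>R outer v \<in> sym_matrices"
    using assms subspace_sym_matrices outer_sym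
    by (intro subspace_add subspace_scale) (auto simp: ryshkov_set_def)
  then show ?thesis
    using assms by (auto simp: ryshkov_set_def quad_form_add quad_form_scaleR quad_form_outer
        intro: add_increasing2)
qed

text \<open>
  Subtracting any positive multiple of the identity makes the form negative at its zero \<open>x\<close>, so
  symmetric matrices arbitrarily close to \<open>Q\<close> fail to be copositive.
\<close>
lemma copositive_zero_in_frontier:
  assumes "Q \<in> copositive K" and "x \<in> K" "x \<noteq> 0" and "quad_form Q x = 0"
  shows "Q \<in> (top_of_set sym_matrices) frontier_of (copositive K)"
proof -
  have sub: "copositive K \<subseteq> sym_matrices"
    by (auto simp: copositive_def)
  have "Q \<notin> (top_of_set sym_matrices) interior_of (copositive K)"
  proof
    assume "Q \<in> (top_of_set sym_matrices) interior_of (copositive K)"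
    then obtain T where T: "open T" "Q \<in> T" "T \<inter> sym_matrices \<subseteq> copositive K"
      by (auto simp: interior_of_def openin_open)
    have "((\<lambda>t. Q + (-t) *\<^sub>R mat 1) \<longlongrightarrow> Q + (-0) *\<^sub>R mat 1) (at_right (0::real))"
      by (intro tendsto_intros)
    then have "\<forall>\<^sub>F t in at_right (0::real). Q + (-t) *\<^sub>R mat 1 \<in> T"
      using T by (intro topological_tendstoD) auto
    then have "\<forall>\<^sub>F t in at_right (0::real). Q + (-t) *\<^sub>R mat 1 \<in> T \<and> t > 0"
      using eventually_at_right_less eventually_conj by blast
    then obtain t :: real where t: "Q + (-t) *\<^sub>R mat 1 \<in> T" "t > 0"
      using eventually_happens trivial_limit_at_right_real by blast
    have "mat 1 \<in> sym_matrices"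
      by (simp add: sym_matrices_def)
    then have "Q + (-t) *\<^sub>R mat 1 \<in> sym_matrices"
      using assms(1) sub subspace_sym_matrices
      by (intro subspace_add subspace_scale) auto
    then have "quad_form (Q + (-t) *\<^sub>R mat 1) x \<ge> 0"
      using T(3) t(1) assms(2) by (auto simp: copositive_def)
    then have "- (t * (x \<bullet> x)) \<ge> 0"
      by (simp add: quad_form_add quad_form_scaleR quad_form_mat_1 assms(4)
          del: scaleR_minus_left)
    with t(2) assms(3) show False
      using inner_gt_zero_iff[of x] by (simp add: mult_le_0_iff del: inner_gt_zero_iff)
  qed
  moreover have "Q \<in> (top_of_set sym_matrices) closure_of (copositive K)"
    using closure_of_subset[of "copositive K" "top_of_set sym_matrices"] assms(1) sub by auto
  ultimately show ?thesis
    by (simp add: frontier_of_def)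
qed

section \<open>Irredundant inequalities of a polytope\<close>

text \<open>
  Each valid inequality cuts out a face of the polytope. The witness of irredundancy for \<open>i\<close> lies on
  the face of \<open>i\<close> and on none of the others, so distinct indices give distinct faces, of which there
  are only finitely many.
\<close>
lemma finite_irredundant_inequalities:
  fixes P :: "'a::euclidean_space set"
  assumes P: "polytope P"
    and valid: "\<And>i x. i \<in> I \<Longrightarrow> x \<in> P \<Longrightarrow> a i \<bullet> x \<ge> b i"
    and irredundant:
      "\<And>i. i \<in> I \<Longrightarrow> \<exists>x\<in>P. a i \<bullet> x = b i \<and> (\<forall>j\<in>I - {i}. a j \<bullet> x > b j)"
  shows "finite I"
proof -
  define F where "F i = P \<inter> {x. a i \<bullet> x = b i}" for i
  have "F i face_of P" if "i \<in> I" for i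
    unfolding F_def using valid[OF that] polytope_imp_convex[OF P]
    by (intro face_of_Int_supporting_hyperplane_ge) auto
  then have "F ` I \<subseteq> {T. T face_of P}"
    by auto
  then have "finite (F ` I)"
    using finite_polytope_faces[OF P] finite_subset by blast
  moreover have "inj_on F I"
  proof (rule inj_onI, rule ccontr)
    fix i j assume ij: "i \<in> I" "j \<in> I" "F i = F j" "i \<noteq> j"
    obtain x where "x \<in> F i" "\<forall>j\<in>I - {i}. a j \<bullet> x > b j"
      using irredundant[OF ij(1)] by (auto simp: F_def)
    moreover from this ij have "x \<in> F j"
      by simp
    ultimately show False
      using ij by (force simp: F_def)
  qed
  ultimately show ?thesis
    by (simp add: finite_image_iff)
qed

section \<open>The sector\<close>

definition sector :: "(real^2) set" where
  "sector = {x. x $ 1 \<ge> 0 \<and> - (x $ 1) + sqrt 2 * x $ 2 \<ge> 0}"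

lemma sector_eq_convex_cone_hull:
  "convex_cone hull {vector [sqrt 2, 1], vector [0, 1]} = sector" (is "?H = ?S")
proof
  have "c *\<^sub>R x \<in> ?S" if "x \<in> ?S" "c \<ge> 0" for c x
  proof -
    have "c * (- (x $ 1) + sqrt 2 * x $ 2) \<ge> 0"
      using that by (simp add: sector_def)
    then show ?thesis
      using that by (simp add: sector_def algebra_simps)
  qed
  moreover have "x + y \<in> ?S" if "x \<in> ?S" "y \<in> ?S" for x y
    using that by (simp add: sector_def distrib_left)
  moreover have "0 \<in> ?S"
    by (simp add: sector_def)
  ultimately have "convex_cone ?S"
    unfolding convex_cone_iff by blast
  then show "?H \<subseteq> ?S"
    by (intro hull_minimal) (auto simp: sector_def)
  show "?S \<subseteq> ?H"
  proof
    fix x :: "real^2" assume x: "x \<in> ?S"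
    have "x = (x $ 1 / sqrt 2) *\<^sub>R vector [sqrt 2, 1] + (x $ 2 - x $ 1 / sqrt 2) *\<^sub>R vector [0, 1]"
      by (simp add: vec_eq_iff forall_2)
    also have "\<dots> \<in> ?H"
      using x by (intro convex_cone_hull_add convex_cone_hull_mul hull_inc)
        (auto simp: sector_def field_simps)
    finally show "x \<in> ?H" .
  qed
qed

section \<open>The Pell form on the sector\<close>

lemma sqrt_2_irrational: "sqrt 2 \<notin> \<rat>"
proof
  assume "sqrt 2 \<in> \<rat>"
  then obtain m n :: nat where mn: "n \<noteq> 0" "\<bar>sqrt 2\<bar> = real m / real n" "coprime m n"
    by (rule Rats_abs_nat_div_natE)
  then have "real m = sqrt 2 * real n"
    by (simp add: field_simps)
  then have "real (m\<^sup>2) = real (2 * n\<^sup>2)"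
    by (simp add: power_mult_distrib)
  then have eq: "m\<^sup>2 = 2 * n\<^sup>2"
    by (simp only: of_nat_eq_iff)
  then have "even m"
    by (metis dvd_triv_left even_power)
  then obtain k where "m = 2 * k" ..
  with eq have "n\<^sup>2 = 2 * k\<^sup>2"
    by (simp add: power_mult_distrib)
  then have "even n"
    by (metis dvd_triv_left even_power)
  with \<open>even m\<close> mn(3) show False
    using coprime_common_divisor by fastforce
qed

definition pell :: "real^2^2" where
  "pell = vector [vector [-1, 0], vector [0, 2]]"

lemma pell_sym: "pell \<in> sym_matrices"
  by (simp add: sym_matrices_def pell_def transpose_def vec_eq_iff forall_2)

lemma quad_form_pell: "quad_form pell x = 2 * (x $ 2)\<^sup>2 - (x $ 1)\<^sup>2"
  by (simp add: pell_def quad_form_def inner_vec_def matrix_vector_mult_def sum_2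
      power2_eq_square)

lemma copositive_pell: "pell \<in> copositive sector"
proof -
  have "quad_form pell x \<ge> 0" if "x \<in> sector" for x
  proof -
    have "(x $ 1)\<^sup>2 \<le> (sqrt 2 * x $ 2)\<^sup>2"
      using that by (intro power_mono) (auto simp: sector_def)
    then show ?thesis
      by (simp add: quad_form_pell power_mult_distrib)
  qed
  then show ?thesis
    by (simp add: copositive_def pell_sym)
qed

text \<open>
  The values at lattice points are nonnegative integers, and a value \<open>0\<close> would make \<open>\<surd>2 = p / q\<close>
  rational.
\<close>
lemma pell_ryshkov: "pell \<in> ryshkov_set sector"
proof -
  have "quad_form pell z \<ge> 1" if z: "z \<in> nonzero_lattice_points sector" for z
  proof -
    from z obtain p q :: int where pq: "z $ 1 = of_int p" "z $ 2 = of_int q"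
      by (auto simp: nonzero_lattice_points_def forall_2 elim!: Ints_cases)
    have eq: "quad_form pell z = of_int (2 * q\<^sup>2 - p\<^sup>2)"
      by (simp add: quad_form_pell pq)
    have "quad_form pell z \<ge> 0"
      using copositive_pell z by (auto simp: copositive_def nonzero_lattice_points_def)
    moreover have "quad_form pell z \<noteq> 0"
    proof
      assume "quad_form pell z = 0"
      then have "(z $ 1)\<^sup>2 = (sqrt 2 * z $ 2)\<^sup>2"
        by (simp add: quad_form_pell power_mult_distrib)
      moreover have "z $ 1 \<ge> 0" "sqrt 2 * z $ 2 \<ge> 0"
        using z by (auto simp: sector_def nonzero_lattice_points_def)
      ultimately have *: "z $ 1 = sqrt 2 * z $ 2"
        by (simp add: power2_eq_iff_nonneg)
      show False
      proof (cases "q = 0")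
        case True
        with * pq have "z = 0"
          by (simp add: vec_eq_iff forall_2)
        with z show False
          by (simp add: nonzero_lattice_points_def)
      next
        case False
        with * pq have "sqrt 2 = of_int p / of_int q"
          by (simp add: field_simps)
        then have "sqrt 2 \<in> \<rat>"
          by simp
        then show False
          using sqrt_2_irrational by simp
      qed
    qed
    ultimately show ?thesis
      unfolding eq by (simp only: of_int_0_le_iff of_int_eq_0_iff of_int_1_le_iff)
  qed
  then show ?thesis
    by (simp add: ryshkov_set_def pell_sym)
qed

text \<open>
  Starting from \<open>(1, 1)\<close>, repeated multiplication of \<open>p + q \<surd>2\<close> by the unit \<open>3 + 2 \<surd>2\<close>, whose norm is
  \<open>1\<close>, produces solutions with growing \<open>q\<close>.
\<close>
lemma pell_solution_above:
  "\<exists>p q :: int. p > 0 \<and> q > int n \<and> 2 * q\<^sup>2 - p\<^sup>2 = 1"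
proof (induction n)
  case 0
  show ?case
    by (intro exI[of _ 1]) simp
next
  case (Suc n)
  then obtain p q :: int where "p > 0" "q > int n" "2 * q\<^sup>2 - p\<^sup>2 = 1"
    by blast
  then show ?case
    by (intro exI[of _ "3 * p + 4 * q"] exI[of _ "2 * p + 3 * q"])
      (auto simp: power2_eq_square algebra_simps)
qed

lemma infinite_pell_minimizers:
  "infinite {z \<in> nonzero_lattice_points sector. quad_form pell z = 1}" (is "infinite ?Z")
proof
  assume "finite ?Z"
  then have "finite ((\<lambda>z. z $ 2) ` ?Z)"
    by simp
  then obtain n :: nat where n: "\<And>z. z \<in> ?Z \<Longrightarrow> z $ 2 \<le> real n"
    using bdd_above_finite real_arch_simple unfolding bdd_above_def
    by (metis (no_types, lifting) imageI order_trans)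
  obtain p q :: int where pq: "p > 0" "q > int n" "2 * q\<^sup>2 - p\<^sup>2 = 1"
    using pell_solution_above by blast
  define z :: "real^2" where "z = vector [of_int p, of_int q]"
  have z: "z $ 1 = of_int p" "z $ 2 = of_int q"
    by (simp_all add: z_def)
  have one: "quad_form pell z = 1"
    using arg_cong[OF pq(3), of real_of_int] by (simp add: quad_form_pell z)
  then have "(z $ 1)\<^sup>2 \<le> (sqrt 2 * z $ 2)\<^sup>2"
    by (simp add: quad_form_pell power_mult_distrib)
  then have "z $ 1 \<le> sqrt 2 * z $ 2"
    by (rule power2_le_imp_le) (use pq in \<open>simp add: z\<close>)
  then have "z \<in> ?Z"
    using one pq by (auto simp: nonzero_lattice_points_def sector_def forall_2 z vec_eq_iff)
  with n[OF this] pq(2) show False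
    by (simp add: z)
qed

text \<open>
  If \<open>w = c z\<close> then the values of the form differ by the factor \<open>c\<^sup>2\<close>, so \<open>c\<^sup>2 = 1\<close>; the sign of the
  second coordinate, which is nonzero because the value \<open>1\<close> is positive, excludes \<open>c = -1\<close>.
\<close>
lemma pell_minimizers_eq_of_parallel:
  fixes z w :: "real^2"
  assumes "quad_form pell z = 1" "quad_form pell w = 1" "z $ 2 \<ge> 0" "w $ 2 \<ge> 0"
    and det: "z $ 2 * w $ 1 = z $ 1 * w $ 2"
  shows "z = w"
proof -
  have zw: "(z $ 1)\<^sup>2 = 2 * (z $ 2)\<^sup>2 - 1" "(w $ 1)\<^sup>2 = 2 * (w $ 2)\<^sup>2 - 1"
    using assms(1,2) by (auto simp: quad_form_pell)
  have "(z $ 2)\<^sup>2 * (w $ 1)\<^sup>2 = (z $ 1)\<^sup>2 * (w $ 2)\<^sup>2"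
    using det by (metis power_mult_distrib)
  then have "(z $ 2)\<^sup>2 = (w $ 2)\<^sup>2"
    unfolding zw by (simp add: algebra_simps)
  then have 2: "z $ 2 = w $ 2"
    using assms(3,4) by (simp add: power2_eq_iff_nonneg)
  moreover have "z $ 2 \<noteq> 0"
  proof
    assume "z $ 2 = 0"
    with zw(1) have "(z $ 1)\<^sup>2 = -1" by simp
    then show False by (metis zero_le_power2 not_one_le_zero neg_0_le_iff_le)
  qed
  ultimately have "z $ 1 = w $ 1"
    using det by simp
  with 2 show ?thesis
    by (simp add: vec_eq_iff forall_2)
qed

theorem theorem5p1:
  fixes K :: "(real^2) set"
  assumes "K = convex_cone hull {vector [sqrt 2, 1], vector [0, 1]}"
  shows "K = {x. x $ 1 \<ge> 0 \<and> - (x $ 1) + sqrt 2 * x $ 2 \<ge> 0}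
         \<and> \<not> interior_ryshkov K
         \<and> \<not> locally_finite_polyhedron (ryshkov_set K)"
proof (intro conjI)
  show K: "K = {x. x $ 1 \<ge> 0 \<and> - (x $ 1) + sqrt 2 * x $ 2 \<ge> 0}"
    unfolding assms sector_eq_convex_cone_hull by (rule sector_def)
  then have sector: "K = sector"
    by (simp only: sector_def)
  note pell = pell_ryshkov[folded sector]
  show "\<not> interior_ryshkov K"
  proof
    assume IR: "interior_ryshkov K"
    define x :: "real^2" where "x = vector [sqrt 2, 1]"
    have "x \<noteq> 0" "x \<in> K" "quad_form pell x = 0"
      by (auto simp: x_def K vec_eq_iff forall_2 quad_form_pell)
    then have "copositive_min K pell = 0"
      using IR copositive_zero_in_frontier[OF copositive_pell[folded sector]]
      by (auto simp: interior_ryshkov_def)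
    moreover have "copositive_min K pell \<ge> 1"
      using pell by (auto simp: copositive_min_def ryshkov_set_def intro!: INF_greatest)
    ultimately show False
      by simp
  qed
  show "\<not> locally_finite_polyhedron (ryshkov_set K)"
  proof
    assume lf: "locally_finite_polyhedron (ryshkov_set K)"
    define Z where "Z = {z \<in> nonzero_lattice_points K. quad_form pell z = 1}"
    obtain b where b: "cball pell 1 \<subseteq> cbox (-b) b"
      using bounded_subset_cbox_symmetric[OF bounded_cball] by blast
    define P where "P = ryshkov_set K \<inter> cbox (-b) b"
    have "finite Z"
    proof (rule finite_irredundant_inequalities[where P = P and a = outer and b = "\<lambda>_. 1"])
      show "polytope P"
        using lf by (simp add: P_def locally_finite_polyhedron_def polytope_interval)
      show "outer z \<bullet> Q \<ge> 1" if "z \<in> Z" "Q \<in> P" for z Q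
        using that by (auto simp: Z_def P_def ryshkov_set_def quad_form_eq_inner_outer)
      fix z assume z: "z \<in> Z"
      \<comment> \<open>\<open>v\<close> is orthogonal to \<open>z\<close>, so the square of \<open>w \<mapsto> v \<bullet> w\<close> vanishes exactly on the multiples
        of \<open>z\<close>.\<close>
      define v :: "real^2" where "v = vector [z $ 2, - (z $ 1)]"
      have v: "v \<bullet> w = z $ 2 * w $ 1 - z $ 1 * w $ 2" for w
        by (simp add: v_def inner_vec_def sum_2)
      have "z \<noteq> 0"
        using z by (auto simp: Z_def nonzero_lattice_points_def)
      then have "v \<noteq> 0"
        by (auto simp: v_def vec_eq_iff forall_2)
      then have "quad_form (outer v) v \<noteq> 0"
        by (simp add: quad_form_outer)
      then have nz: "outer v \<noteq> 0"
        by (auto simp: quad_form_eq_inner_outer)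
      \<comment> \<open>Normalising the perturbation keeps \<open>Q\<close> within distance \<open>1\<close> of the Pell form, hence in
        the box.\<close>
      define Q where "Q = pell + inverse (norm (outer v)) *\<^sub>R outer v"
      have form: "quad_form Q w = quad_form pell w + (v \<bullet> w)\<^sup>2 / norm (outer v)" for w
        by (simp add: Q_def quad_form_add quad_form_scaleR quad_form_outer field_simps)
      have "Q \<in> cball pell 1"
        using nz by (simp add: Q_def dist_norm)
      then have "Q \<in> P"
        using b ryshkov_add_outer[OF pell] by (auto simp: P_def Q_def)
      moreover have "quad_form Q z = 1"
        using z by (simp add: form v Z_def)
      moreover have "quad_form Q w > 1" if w: "w \<in> Z - {z}" for w
      proof -
        have nonneg: "0 \<le> u $ 2" if "u \<in> Z" for u
        proof -
          have "0 \<le> sqrt 2 * u $ 2"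
            using that by (auto simp: Z_def nonzero_lattice_points_def K)
          then show ?thesis
            by (simp add: zero_le_mult_iff)
        qed
        have "v \<bullet> w \<noteq> 0"
          using pell_minimizers_eq_of_parallel[of z w] nonneg[of z] nonneg[of w] z w
          by (auto simp: v Z_def)
        then show ?thesis
          using w nz by (simp add: form Z_def)
      qed
      ultimately show "\<exists>Q\<in>P. outer z \<bullet> Q = 1 \<and> (\<forall>w\<in>Z - {z}. outer w \<bullet> Q > 1)"
        by (auto simp: quad_form_eq_inner_outer)
    qed
    then show False
      using infinite_pell_minimizers[folded sector] by (simp add: Z_def)
  qed
qed

end
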